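(* Let $F:\mathbb{R}^n\to\mathbb{R}^m$ be continuous, and let $C\in\mathbb{R}^{m\times r}$ with $r\le m$ have full column rank, with QR factorization $C=QR$ where $Q\in\mathbb{R}^{m\times r}$ has orthonormal columns and $R\in\mathbb{R}^{r\times r}$ is diagonal with positive diagonal entries. Let $\lambda\ge 0$, let $x_{ls}\in\mathop{\mathrm{argmin}}_x\|F(x)\|^2$ be a least squares solution and let $x^\lambda_{rls}\in\mathop{\mathrm{argmin}}_x\big(\|F(x)\|^2+2\lambda\|C^\top F(x)\|_1\big)$ be a $\lambda$-robust least squares solution. For $\delta\ge 0$ let $$Er_\delta(x)=\max_{\|y\|_\infty\le\delta}\|F(x)-Cy\|^2,\qquad \Delta_\lambda(\delta)=Er_\delta(x_{ls})-Er_\delta(x^\lambda_{rls}).$$ If $x_{ls}$ is not a $\lambda$-robust least squares solution, then $\Delta_\lambda(\delta)$ increases linearly with respect to $\delta$ (i.e. it is an affine, increasing function of $\delta\ge0$) with rate (slope) $$2\big(\|C^\top F(x_{ls})\|_1-\|C^\top F(x^\lambda_{rls})\|_1\big),$$ and $\Delta_\lambda(\delta)>0$ whenever $$\delta>\frac{\|F(x^\lambda_{rls})\|^2-\|F(x_{ls})\|^2}{2\big(\|C^\top F(x_{ls})\|_1-\|C^\top F(x^\lambda_{rls})\|_1\big)} .$$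
   Context: $\|\cdot\|$ is the Euclidean norm, $\|\cdot\|_1$ the vector $\ell_1$ norm and $\|\cdot\|_\infty$ the max norm. A $\lambda$-robust least squares solution is any minimizer over $\mathbb{R}^n$ of $\|F(x)\|^2+2\lambda\|C^\top F(x)\|_1$. *)

theory Defs
  imports "HOL-Analysis.Analysis"
begin

definition l1_norm :: "real ^ 'n \<Rightarrow> real" where
  "l1_norm v = (\<Sum>i\<in>UNIV. \<bar>v $ i\<bar>)"

definition orthonormal_columns :: "real ^ 'r ^ 'm \<Rightarrow> bool" where
  "orthonormal_columns Q \<longleftrightarrow>
     (\<forall>i. norm (column i Q) = 1) \<and>
     (\<forall>i j. i \<noteq> j \<longrightarrow> orthogonal (column i Q) (column j Q))"

definition positive_diagonal :: "real ^ 'r ^ 'r \<Rightarrow> bool" where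
  "positive_diagonal R \<longleftrightarrow> (\<forall>i j. i \<noteq> j \<longrightarrow> R $ i $ j = 0) \<and> (\<forall>i. R $ i $ i > 0)"

definition least_squares_solution :: "(real ^ 'n \<Rightarrow> real ^ 'm) \<Rightarrow> real ^ 'n \<Rightarrow> bool" where
  "least_squares_solution F = is_arg_min (\<lambda>x. (norm (F x))\<^sup>2) (\<lambda>_. True)"

definition robust_ls_solution ::
  "(real ^ 'n \<Rightarrow> real ^ 'm) \<Rightarrow> real ^ 'r ^ 'm \<Rightarrow> real \<Rightarrow> real ^ 'n \<Rightarrow> bool" where
  "robust_ls_solution F C lam =
     is_arg_min (\<lambda>x. (norm (F x))\<^sup>2 + 2 * lam * l1_norm (transpose C *v F x)) (\<lambda>_. True)"

(* A genuine maximum rather than a supremum: the greatest element of the set of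
   attained values, which is unspecified if that set has no greatest element.
   infnorm is the max norm of the coordinates. *)
definition Er ::
  "(real ^ 'n \<Rightarrow> real ^ 'm) \<Rightarrow> real ^ 'r ^ 'm \<Rightarrow> real \<Rightarrow> real ^ 'n \<Rightarrow> real" where
  "Er F C \<delta> x = (GREATEST v. \<exists>y. infnorm y \<le> \<delta> \<and> v = (norm (F x - C *v y))\<^sup>2)"

end

theory Submission
  imports Defs
begin

text \<open>
  Since \<open>R\<close> is diagonal, the columns of \<open>C = Q R\<close> are pairwise orthogonal, so
  \<open>\<parallel>F(x) - C y\<parallel>\<^sup>2\<close> has no mixed terms \<open>y\<^sub>i y\<^sub>j\<close>: it is \<open>\<parallel>F(x)\<parallel>\<^sup>2\<close> plus a sum of
  one-variable convex parabolas in the coordinates \<open>y\<^sub>i\<close>. The constraint \<open>\<parallel>y\<parallel>\<^sub>\<infinity> \<le> \<delta>\<close> is also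
  coordinatewise, so each parabola can be maximised separately, at whichever endpoint \<open>\<plusminus>\<delta>\<close>
  makes its linear term nonnegative. This gives the closed form of lemma
  \<open>Er_orthogonal_columns\<close>,
  \<open>Er\<^sub>\<delta>(x) = \<parallel>F(x)\<parallel>\<^sup>2 + 2 \<delta> \<parallel>C\<^sup>T F(x)\<parallel>\<^sub>1 + \<delta>\<^sup>2 \<Sum>\<^sub>i \<parallel>c\<^sub>i\<parallel>\<^sup>2\<close>,
  where \<open>c\<^sub>i\<close> are the columns of \<open>C\<close>.

  The term quadratic in \<open>\<delta>\<close> does not depend on \<open>x\<close> and cancels in \<open>\<Delta>\<close>, which is therefore
  affine with the stated slope. The slope is positive because passing from \<open>x\<^sub>l\<^sub>s\<close> to the robust
  solution strictly lowers the regularised objective while it cannot lower \<open>\<parallel>F\<parallel>\<^sup>2\<close>, so it must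
  lower \<open>\<parallel>C\<^sup>T F\<parallel>\<^sub>1\<close> (lemma \<open>l1_norm_robust_less\<close>). The threshold for \<open>\<delta>\<close> is the zero of the
  affine function.
\<close>

lemma infnorm_cart_le_iff:
  fixes y :: "real ^ 'r"
  shows "infnorm y \<le> \<delta> \<longleftrightarrow> (\<forall>i. \<bar>y $ i\<bar> \<le> \<delta>)"
proof
  assume "infnorm y \<le> \<delta>"
  then show "\<forall>i. \<bar>y $ i\<bar> \<le> \<delta>"
    using component_le_infnorm_cart order_trans by blast
next
  assume "\<forall>i. \<bar>y $ i\<bar> \<le> \<delta>"
  then show "infnorm y \<le> \<delta>"
    unfolding infnorm_cart by (intro cSup_least) auto
qed

lemma column_mult_diagonal:
  fixes Q :: "real ^ 'r ^ 'm" and R :: "real ^ 'r ^ 'r"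
  assumes "\<And>i j. i \<noteq> j \<Longrightarrow> R $ i $ j = 0"
  shows "column j (Q ** R) = R $ j $ j *\<^sub>R column j Q"
proof -
  have "(\<Sum>k\<in>UNIV. Q $ i $ k * R $ k $ j) = R $ j $ j * Q $ i $ j" for i
  proof -
    have "(\<Sum>k\<in>UNIV. Q $ i $ k * R $ k $ j)
        = (\<Sum>k\<in>UNIV. if k = j then R $ j $ j * Q $ i $ j else 0)"
      using assms by (intro sum.cong) auto
    then show ?thesis by simp
  qed
  then show ?thesis
    by (simp add: vec_eq_iff column_def matrix_matrix_mult_def)
qed

lemma norm_diff_orthogonal_columns:
  fixes C :: "real ^ 'r ^ 'm"
  assumes "\<And>i j. i \<noteq> j \<Longrightarrow> orthogonal (column i C) (column j C)"
  shows "(norm (a - C *v y))\<^sup>2 = (norm a)\<^sup>2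
    + (\<Sum>i\<in>UNIV. (norm (column i C))\<^sup>2 * (y $ i)\<^sup>2 - 2 * y $ i * (transpose C *v a) $ i)"
proof -
  have "(norm (C *v y))\<^sup>2 = (norm (\<Sum>i\<in>UNIV. y $ i *\<^sub>R column i C))\<^sup>2"
    by (simp add: matrix_mult_sum scalar_mult_eq_scaleR)
  also have "\<dots> = (\<Sum>i\<in>UNIV. (norm (y $ i *\<^sub>R column i C))\<^sup>2)"
    using assms
    by (intro norm_sum_Pythagorean) (auto simp: pairwise_def orthogonal_clauses)
  finally have sq: "(norm (C *v y))\<^sup>2 = (\<Sum>i\<in>UNIV. (norm (column i C))\<^sup>2 * (y $ i)\<^sup>2)"
    by (simp add: power_mult_distrib mult.commute)
  have "a \<bullet> (C *v y) = y \<bullet> (transpose C *v a)"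
    by (metis dot_lmul_matrix inner_commute transpose_matrix_vector)
  then have cross: "a \<bullet> (C *v y) = (\<Sum>i\<in>UNIV. y $ i * (transpose C *v a) $ i)"
    by (simp add: inner_vec_def)
  have "(norm (a - C *v y))\<^sup>2 = (norm a)\<^sup>2 + (norm (C *v y))\<^sup>2 - 2 * (a \<bullet> (C *v y))"
    by (simp add: power2_norm_eq_inner inner_diff inner_commute)
  then show ?thesis
    unfolding sq cross by (simp add: sum_subtractf sum_distrib_left mult.assoc)
qed

text \<open>
  Orthogonality decouples the coordinates of \<open>y\<close>, so the worst perturbation has every coordinate
  of modulus \<open>\<delta>\<close>, with sign opposite to that of the corresponding coordinate of \<open>C\<^sup>T F(x)\<close>.
\<close>
lemma Er_orthogonal_columns:
  fixes F :: "real ^ 'n \<Rightarrow> real ^ 'm" and C :: "real ^ 'r ^ 'm"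
  assumes orth: "\<And>i j. i \<noteq> j \<Longrightarrow> orthogonal (column i C) (column j C)"
    and "\<delta> \<ge> 0"
  shows "Er F C \<delta> x = (norm (F x))\<^sup>2 + 2 * \<delta> * l1_norm (transpose C *v F x)
    + \<delta>\<^sup>2 * (\<Sum>i\<in>UNIV. (norm (column i C))\<^sup>2)"
proof -
  define g where "g = transpose C *v F x"
  define q where "q y i = (norm (column i C))\<^sup>2 * (y $ i)\<^sup>2 - 2 * y $ i * g $ i"
    for y :: "real ^ 'r" and i
  define M where "M i = (norm (column i C))\<^sup>2 * \<delta>\<^sup>2 + 2 * \<delta> * \<bar>g $ i\<bar>" for i
  have expand: "(norm (F x - C *v y))\<^sup>2 = (norm (F x))\<^sup>2 + (\<Sum>i\<in>UNIV. q y i)" for y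
    unfolding q_def g_def by (rule norm_diff_orthogonal_columns[OF orth])
  have upper: "q y i \<le> M i" if "infnorm y \<le> \<delta>" for y i
  proof -
    have y: "\<bar>y $ i\<bar> \<le> \<delta>"
      using that by (simp add: infnorm_cart_le_iff)
    have "(y $ i)\<^sup>2 \<le> \<delta>\<^sup>2"
      using y by (metis abs_ge_zero power2_abs power_mono)
    then have "(norm (column i C))\<^sup>2 * (y $ i)\<^sup>2 \<le> (norm (column i C))\<^sup>2 * \<delta>\<^sup>2"
      by (simp add: mult_left_mono)
    moreover have "- (y $ i * g $ i) \<le> \<delta> * \<bar>g $ i\<bar>"
      using mult_right_mono[OF y, of "\<bar>g $ i\<bar>"] abs_ge_minus_self[of "y $ i * g $ i"]
      by (simp add: abs_mult)
    ultimately show ?thesis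
      unfolding q_def M_def by (simp add: mult.assoc)
  qed
  \<comment> \<open>The sign function vanishes at 0, so it cannot be used here: the quadratic part
      needs modulus \<open>\<delta>\<close> also in the coordinates where \<open>g\<close> is zero.\<close>
  define w :: "real ^ 'r" where "w = (\<chi> i. if g $ i \<ge> 0 then - \<delta> else \<delta>)"
  have w: "infnorm w \<le> \<delta>"
    using \<open>\<delta> \<ge> 0\<close> by (simp add: infnorm_cart_le_iff w_def)
  have attained: "q w i = M i" for i
    by (simp add: q_def M_def w_def)
  have "Er F C \<delta> x = (norm (F x))\<^sup>2 + (\<Sum>i\<in>UNIV. M i)"
    unfolding Er_def
  proof (rule Greatest_equality)
    show "\<exists>y. infnorm y \<le> \<delta> \<and> (norm (F x))\<^sup>2 + (\<Sum>i\<in>UNIV. M i) = (norm (F x - C *v y))\<^sup>2"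
      using w by (intro exI[of _ w]) (simp add: expand attained)
  next
    fix v
    assume "\<exists>y. infnorm y \<le> \<delta> \<and> v = (norm (F x - C *v y))\<^sup>2"
    then show "v \<le> (norm (F x))\<^sup>2 + (\<Sum>i\<in>UNIV. M i)"
      using sum_mono[OF upper] by (auto simp: expand)
  qed
  also have "(\<Sum>i\<in>UNIV. M i) = 2 * \<delta> * l1_norm g + \<delta>\<^sup>2 * (\<Sum>i\<in>UNIV. (norm (column i C))\<^sup>2)"
    by (simp add: M_def l1_norm_def sum.distrib sum_distrib_left mult.commute)
  finally show ?thesis
    by (simp add: g_def)
qed

text \<open>
  A least squares solution that is not robust has a strictly larger regularised objective than
  any robust one; its residual norm is minimal, so the whole excess comes from the penalty.
\<close>
lemma l1_norm_robust_less:
  fixes F :: "real ^ 'n \<Rightarrow> real ^ 'm" and C :: "real ^ 'r ^ 'm"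
  assumes "lam \<ge> 0"
    and "least_squares_solution F x_ls"
    and rls: "robust_ls_solution F C lam x_rls"
    and not_rls: "\<not> robust_ls_solution F C lam x_ls"
  shows "l1_norm (transpose C *v F x_rls) < l1_norm (transpose C *v F x_ls)"
proof -
  have "(norm (F x_ls))\<^sup>2 \<le> (norm (F x_rls))\<^sup>2"
    using assms(2) by (simp add: least_squares_solution_def is_arg_min_linorder)
  moreover have "(norm (F x_rls))\<^sup>2 + 2 * lam * l1_norm (transpose C *v F x_rls)
      < (norm (F x_ls))\<^sup>2 + 2 * lam * l1_norm (transpose C *v F x_ls)"
    using rls not_rls unfolding robust_ls_solution_def is_arg_min_linorder
    by (meson le_less_trans not_le)
  ultimately have "lam * l1_norm (transpose C *v F x_rls) < lam * l1_norm (transpose C *v F x_ls)"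
    by linarith
  then show ?thesis
    using \<open>lam \<ge> 0\<close> by (simp add: mult_less_cancel_left)
qed

theorem proposition5p1:
  fixes F :: "real ^ 'n \<Rightarrow> real ^ 'm"
    and C Q :: "real ^ 'r ^ 'm"
    and R :: "real ^ 'r ^ 'r"
    and lam :: real
    and x_ls x_rls :: "real ^ 'n"
    and \<Delta> :: "real \<Rightarrow> real"
    and slope :: real
  assumes "continuous_on UNIV F"
    and "CARD('r) \<le> CARD('m)"
    and "rank C = CARD('r)"
    and "C = Q ** R"
    and "orthonormal_columns Q"
    and "positive_diagonal R"
    and "lam \<ge> 0"
    and "least_squares_solution F x_ls"
    and "robust_ls_solution F C lam x_rls"
    and "\<not> robust_ls_solution F C lam x_ls"
  defines "\<Delta> \<equiv> \<lambda>\<delta>. Er F C \<delta> x_ls - Er F C \<delta> x_rls"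
    and "slope \<equiv> 2 * (l1_norm (transpose C *v F x_ls) - l1_norm (transpose C *v F x_rls))"
  shows "(\<exists>b. \<forall>\<delta>\<ge>0. \<Delta> \<delta> = b + slope * \<delta>) \<and>
         strict_mono_on {0..} \<Delta> \<and>
         (\<forall>\<delta>\<ge>0. \<delta> > ((norm (F x_rls))\<^sup>2 - (norm (F x_ls))\<^sup>2) / slope \<longrightarrow> \<Delta> \<delta> > 0)"
proof -
  define b where "b = (norm (F x_ls))\<^sup>2 - (norm (F x_rls))\<^sup>2"
  have "column i C = R $ i $ i *\<^sub>R column i Q" for i
    using \<open>C = Q ** R\<close> \<open>positive_diagonal R\<close>
    by (simp add: column_mult_diagonal positive_diagonal_def)
  then have "orthogonal (column i C) (column j C)" if "i \<noteq> j" for i j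
    using \<open>orthonormal_columns Q\<close> that
    by (simp add: orthonormal_columns_def orthogonal_clauses)
  then have affine: "\<Delta> \<delta> = b + slope * \<delta>" if "\<delta> \<ge> 0" for \<delta>
    using that by (simp add: \<Delta>_def slope_def b_def Er_orthogonal_columns algebra_simps)
  have "slope > 0"
    using l1_norm_robust_less[OF assms(7-10)] by (simp add: slope_def)
  have "strict_mono_on {0..} \<Delta>"
    using \<open>slope > 0\<close> by (auto simp: strict_mono_on_def affine)
  moreover have "\<Delta> \<delta> > 0"
    if "\<delta> \<ge> 0" "\<delta> > ((norm (F x_rls))\<^sup>2 - (norm (F x_ls))\<^sup>2) / slope" for \<delta>
    using that \<open>slope > 0\<close> by (simp add: affine b_def pos_divide_less_eq algebra_simps)
  ultimately show ?thesis
    using affine by blast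
qed

end
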